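(* For every integer $n\geq 2$ and every integer $M\geq 1$, $$\delta_{n}(M)\ \geq\ \beta_{n}(M)=1-\frac{\min\{n-1,M\}}{M},$$ where, for each fixed $n\geq 2$, $$\beta_{n}(M)\asymp 1-\frac{n-1}{M}\qquad\text{as } M\to\infty .$$
   Context: $\Gamma$ denotes the Euler Gamma function and $\Gamma^{(n)}$ its $n$-th derivative; "transcendental" means transcendental over $\mathbb{Q}$. For fixed $n\in\mathbb{Z}_{\geq 2}$ and $M\in\mathbb{Z}_{\geq 1}$, the density of transcendental values is $$\delta_{n}(M)=\frac{\#\left\{m\in\{1,2,\ldots,M\} : \Gamma^{(n)}(m)\ \text{is transcendental}\right\}}{M}.$$ The function $\beta_n(M)$ is defined by the displayed formula in the claim. The notation $f(M)\asymp g(M)$ as $M\to\infty$ means asymptotic equivalence: $f(M)/g(M)\to 1$ as $M\to\infty$. *)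

theory Defs
  imports
    "HOL-Complex_Analysis.Complex_Analysis"
    "HOL-Library.Landau_Symbols"
    "HOL-Computational_Algebra.Polynomial"
begin

text \<open>
  The library predicate \<^const>\<open>algebraic\<close> asks for a nonzero annihilating polynomial with integer
  coefficients; by \<open>algebraic_altdef\<close> this is the same as algebraicity over the rationals.
\<close>
definition transcendental :: "complex \<Rightarrow> bool" where
  "transcendental z \<longleftrightarrow> \<not> algebraic z"

definition transcendence_density :: "nat \<Rightarrow> nat \<Rightarrow> real" where
  "transcendence_density n M =
     real (card {m \<in> {1..M}. transcendental ((deriv ^^ n) Gamma (of_nat m))}) / real M"

definition density_bound :: "nat \<Rightarrow> nat \<Rightarrow> real" where
  "density_bound n M = 1 - min (real n - 1) (real M) / real M"

end

theory Submission imports Defs "HOL-Computational_Algebra.Fundamental_Theorem_Algebra" begin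

text \<open>
  The theorem says that for fixed \<open>n \<ge> 2\<close> at most \<open>n - 1\<close> of the values \<open>\<Gamma>\<^sup>(\<^sup>n\<^sup>)(m)\<close> at positive integers
  \<open>m\<close> are algebraic; everything about densities is counting. Two ingredients give this.

  The first is linear algebra over the rationals. Put \<open>u n N = \<Gamma>\<^sup>(\<^sup>n\<^sup>)(N + 1) / (n! N!)\<close>. Then
  \<open>u 0 N = 1\<close>, and differentiating \<open>\<Gamma>(z + 1) = z \<Gamma>(z)\<close> gives
  \<open>u (n + 1) (N + 1) - u (n + 1) N = u n N / (N + 1)\<close> (\<open>gamma_taylor_step\<close>).
  Let \<open>\<phi>\<close> be a rational-linear map from the complex numbers to the rationals that vanishes on all algebraic numbers.
  The rational array \<open>w n N = \<phi> (u n N)\<close> obeys the same recurrence and has \<open>w 0 = 0\<close>. If row \<open>n\<close> of \<open>w\<close>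
  has \<open>n\<close> zeros, a discrete form of Rolle's theorem forces the whole row to vanish
  (\<open>vanishing_of_zeros\<close>), and with it all earlier rows. So if \<open>\<Gamma>\<^sup>(\<^sup>n\<^sup>)\<close> were algebraic at \<open>n\<close> positive
  integers, every such \<open>\<phi>\<close> would kill \<open>\<Gamma>'(1)\<close> and \<open>\<Gamma>''(1)\<close>. Since a nonalgebraic number is sent to \<open>1\<close> by
  some \<open>\<phi>\<close> (\<open>rational_functional\<close>), both derivatives would be algebraic. But
  \<open>\<Gamma>''(1) - \<Gamma>'(1)\<^sup>2 = \<pi>\<^sup>2 / 6\<close>.

  The second ingredient is therefore the transcendence of \<open>\<pi>\<close>, together with the fact that algebraic
  numbers form a ring. Both use the same device in place of symmetric function theory: a finite list of
  complex numbers has a rational polynomial exactly when all its power sums are rational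
  (\<open>rational_coeffs_iff_power_sums\<close>), and power sums of lists of pairwise sums, pairwise products or
  subset sums are easy to compute from those of the original lists. For \<open>\<pi>\<close> this is combined with Niven's form of the
  Hermite--Lindemann argument: if \<open>\<i>\<pi>\<close> were a root of a rational polynomial with
  roots \<open>x\<^sub>1, \<dots>, x\<^sub>d\<close>, expanding \<open>(1 + exp x\<^sub>1) \<dots> (1 + exp x\<^sub>d) = 0\<close> would give a relation
  \<open>K + \<Sum>exp \<beta>\<^sub>j = 0\<close> with \<open>K > 0\<close> and the nonzero subset sums \<open>\<beta>\<^sub>j\<close>, and such a relation is refuted by a nonzero
  integer of absolute value below \<open>1\<close> (\<open>sum_exp_integral_roots_nonzero\<close>).
\<close>

unbundle no vec_syntax

section \<open>Power sums and polynomials with given roots\<close>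

definition power_sum :: "complex list \<Rightarrow> nat \<Rightarrow> complex" where
  "power_sum xs k = (\<Sum>x\<leftarrow>xs. x ^ k)"

definition linear_factors :: "complex list \<Rightarrow> complex poly" where
  "linear_factors xs = (\<Prod>x\<leftarrow>xs. [:- x, 1:])"

text \<open>
  The reversed polynomial has constant coefficient \<open>1\<close>, so as a formal power series it is
  invertible over any ring; this makes Newton's identities a single division of power series.
\<close>
definition reversed_factors :: "complex list \<Rightarrow> complex fps" where
  "reversed_factors xs = (\<Prod>x\<leftarrow>xs. 1 - fps_const x * fps_X)"

lemma power_sum_Nil [simp]: "power_sum [] k = 0"
  and power_sum_Cons [simp]: "power_sum (x # xs) k = x ^ k + power_sum xs k"
  and power_sum_append [simp]: "power_sum (xs @ ys) k = power_sum xs k + power_sum ys k"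
  and power_sum_0 [simp]: "power_sum xs 0 = of_nat (length xs)"
  by (simp_all add: power_sum_def sum_list_triv)

lemma power_sum_map_mult: "power_sum (map ((*) c) xs) k = c ^ k * power_sum xs k"
  by (induction xs) (simp_all add: power_mult_distrib ring_distribs)

lemma linear_factors_simps [simp]:
  "linear_factors [] = 1" "linear_factors (x # xs) = [:- x, 1:] * linear_factors xs"
  by (simp_all add: linear_factors_def)

lemma lead_coeff_linear_factors [simp]: "lead_coeff (linear_factors xs) = 1"
  by (induction xs) (simp_all only: linear_factors_simps lead_coeff_mult, simp_all)

lemma linear_factors_nonzero [simp]: "linear_factors xs \<noteq> 0"
  using lead_coeff_linear_factors[of xs] by fastforce

lemma poly_linear_factors_eq_0_iff: "poly (linear_factors xs) z = 0 \<longleftrightarrow> z \<in> set xs"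
  by (induction xs) auto

lemma reversed_factors_simps [simp]:
  "reversed_factors [] = 1"
  "reversed_factors (x # xs) = (1 - fps_const x * fps_X) * reversed_factors xs"
  by (simp_all add: reversed_factors_def)

lemma reversed_factors_nth_0 [simp]: "reversed_factors xs $ 0 = 1"
  by (induction xs) simp_all

lemma fps_of_reflect_linear_factors:
  "fps_of_poly (reflect_poly (linear_factors xs)) = reversed_factors xs"
proof (induction xs)
  case (Cons x xs)
  have "fps_of_poly (reflect_poly [:- x, 1:]) = 1 - fps_const x * fps_X"
    by (cases "x = 0")
       (simp_all add: reflect_poly_def fps_of_poly_pCons flip: fps_const_neg)
  then show ?case
    using Cons.IH by (simp only: linear_factors_simps reflect_poly_mult fps_of_poly_mult reversed_factors_simps)
qed simp

lemma reversed_factors_nth: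
  "reversed_factors xs $ n = coeff (reflect_poly (linear_factors xs)) n"
  by (metis fps_of_reflect_linear_factors fps_of_poly_nth)

text \<open>
  Reversal only permutes coefficients and adds or drops zeros, which matter if \<open>0\<close> is a root.
\<close>
lemma coeffs_reversed_iff:
  assumes "0 \<in> R"
  shows "(\<forall>n. reversed_factors xs $ n \<in> R) \<longleftrightarrow> (\<forall>n. coeff (linear_factors xs) n \<in> R)"
proof
  assume *: "\<forall>n. reversed_factors xs $ n \<in> R"
  show "\<forall>n. coeff (linear_factors xs) n \<in> R"
  proof
    fix n
    show "coeff (linear_factors xs) n \<in> R"
    proof (cases "n \<le> degree (linear_factors xs)")
      case True
      then show ?thesis
        using *[rule_format, of "degree (linear_factors xs) - n"]
        by (simp add: reversed_factors_nth coeff_reflect_poly split: if_splits)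
    next
      case False
      then show ?thesis using assms by (simp add: coeff_eq_0)
    qed
  qed
next
  assume "\<forall>n. coeff (linear_factors xs) n \<in> R"
  then show "\<forall>n. reversed_factors xs $ n \<in> R"
    using assms by (simp add: reversed_factors_nth coeff_reflect_poly)
qed

text \<open>
  Newton's identities in differential form: the logarithmic derivative of \<open>1 - x X\<close> is minus the geometric
  series \<open>\<Sum>x\<^sup>n\<^sup>+\<^sup>1 X\<^sup>n\<close>, and logarithmic derivatives add up over factors.
\<close>
lemma fps_deriv_reversed_factors:
  "fps_deriv (reversed_factors xs) = - Abs_fps (\<lambda>n. power_sum xs (Suc n)) * reversed_factors xs"
proof (induction xs)
  case Nil
  then show ?case by (simp add: fps_eq_iff fps_mult_nth)
next
  case (Cons x xs)
  let ?g = "Abs_fps (\<lambda>n. x ^ Suc n)" and ?G = "Abs_fps (\<lambda>n. power_sum xs (Suc n))"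
  have g: "?g * (1 - fps_const x * fps_X) = fps_const x"
  proof (rule fps_ext)
    fix n
    have "?g * (1 - fps_const x * fps_X) = ?g - fps_const x * (fps_X * ?g)"
      by (simp add: algebra_simps)
    then show "(?g * (1 - fps_const x * fps_X)) $ n = fps_const x $ n"
      by (cases n) simp_all
  qed
  have "Abs_fps (\<lambda>n. power_sum (x # xs) (Suc n)) = ?g + ?G"
    by (simp add: fps_eq_iff)
  then have "- Abs_fps (\<lambda>n. power_sum (x # xs) (Suc n)) * reversed_factors (x # xs)
     = - (?g * (1 - fps_const x * fps_X)) * reversed_factors xs
       + (1 - fps_const x * fps_X) * (- ?G * reversed_factors xs)"
    by (simp add: algebra_simps)
  also have "\<dots> = fps_deriv (reversed_factors (x # xs))"
    unfolding g Cons.IH[symmetric] by simp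
  finally show ?case by simp
qed

text \<open>
  Comparing coefficients determines \<open>(m + 1) F\<^sub>m\<^sub>+\<^sub>1\<close> from earlier ones. Solving for \<open>F\<^sub>m\<^sub>+\<^sub>1\<close> divides by \<open>m + 1\<close>, so
  the ring of coefficients has to contain the rationals.
\<close>
lemma fps_ode_rational:
  fixes F G :: "complex fps"
  assumes ode: "fps_deriv F = G * F"
    and F0: "F $ 0 \<in> \<rat>" and G: "\<And>n. G $ n \<in> \<rat>"
  shows "F $ n \<in> \<rat>"
proof (induction n rule: less_induct)
  case (less n)
  show ?case
  proof (cases n)
    case 0
    then show ?thesis using F0 by simp
  next
    case (Suc m)
    have "of_nat (Suc m) * F $ Suc m = (\<Sum>i=0..m. G $ i * F $ (m - i))"
      using arg_cong[OF ode, of "\<lambda>f. f $ m"] by (simp add: fps_mult_nth)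
    moreover have "(\<Sum>i=0..m. G $ i * F $ (m - i)) \<in> \<rat>"
      using less.IH Suc G by (intro Rats_sum Rats_mult) auto
    ultimately have "of_nat (Suc m) * F $ Suc m / of_nat (Suc m) \<in> \<rat>"
      by (metis Rats_divide Rats_of_nat)
    then show ?thesis
      using Suc by (simp del: of_nat_Suc)
  qed
qed

text \<open>
  Division by a series with constant coefficient \<open>1\<close> creates no denominators. The coefficient
  ring \<open>R\<close> is kept general because it is used both for the rationals and for the integers.
\<close>
lemma fps_quotient_closed:
  fixes F G H :: "complex fps"
  assumes eq: "G * F = H" and F0: "F $ 0 = 1"
    and R0: "0 \<in> R" and diff: "\<And>a b. a \<in> R \<Longrightarrow> b \<in> R \<Longrightarrow> a - b \<in> R"
    and mult: "\<And>a b. a \<in> R \<Longrightarrow> b \<in> R \<Longrightarrow> a * b \<in> R"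
    and F: "\<And>n. F $ n \<in> R" and H: "\<And>n. H $ n \<in> R"
  shows "G $ n \<in> R"
proof (induction n rule: less_induct)
  case (less n)
  have add: "a + b \<in> R" if "a \<in> R" "b \<in> R" for a b
    using diff[OF that(1) diff[OF R0 that(2)]] by simp
  have sum: "(\<Sum>i\<in>A. f i) \<in> R" if "\<And>i. i \<in> A \<Longrightarrow> f i \<in> R" for f and A :: "nat set"
    using that by (induction A rule: infinite_finite_induct) (auto simp: R0 add)
  have "H $ n = (\<Sum>i=0..n. G $ i * F $ (n - i))"
    by (simp add: fps_mult_nth flip: eq)
  also have "\<dots> = (\<Sum>i<n. G $ i * F $ (n - i)) + G $ n"
    by (simp add: F0 atLeast0AtMost flip: lessThan_Suc_atMost)
  finally have "G $ n = H $ n - (\<Sum>i<n. G $ i * F $ (n - i))"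
    by simp
  moreover have "(\<Sum>i<n. G $ i * F $ (n - i)) \<in> R"
    by (intro sum mult F less.IH) simp
  ultimately show ?case using diff H by simp
qed

lemma power_sum_closed:
  assumes coeffs: "\<And>n. coeff (linear_factors xs) n \<in> R"
    and R: "0 \<in> R" "1 \<in> R" "\<And>a b. a \<in> R \<Longrightarrow> b \<in> R \<Longrightarrow> a - b \<in> R"
      "\<And>a b. a \<in> R \<Longrightarrow> b \<in> R \<Longrightarrow> a * b \<in> R"
  shows "power_sum xs (Suc n) \<in> R"
proof -
  let ?F = "reversed_factors xs"
  have F: "?F $ n \<in> R" for n
    using coeffs coeffs_reversed_iff[OF R(1)] by blast
  have neg: "- a \<in> R" if "a \<in> R" for a
    using R(3)[OF R(1) that] by simp
  have nat: "of_nat n \<in> R" for n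
  proof (induction n)
    case (Suc n)
    then show ?case using R(3)[OF Suc neg[OF R(2)]] by (simp add: add.commute)
  qed (simp add: R)
  have "Abs_fps (\<lambda>n. power_sum xs (Suc n)) $ n \<in> R"
  proof (rule fps_quotient_closed[where R = R, OF _ reversed_factors_nth_0[of xs]])
    show "Abs_fps (\<lambda>n. power_sum xs (Suc n)) * ?F = - fps_deriv ?F"
      by (simp add: fps_deriv_reversed_factors)
    show "(- fps_deriv ?F) $ n \<in> R" for n
      using R(4)[OF nat F] neg by (simp del: of_nat_Suc)
  qed (use R F in auto)
  then show ?thesis by simp
qed

text \<open>
  From coefficients to power sums this is a division; from power sums to coefficients it is the solution of the
  differential equation above.
\<close>
lemma rational_coeffs_iff_power_sums:
  "(\<forall>n. coeff (linear_factors xs) n \<in> \<rat>) \<longleftrightarrow> (\<forall>k. power_sum xs k \<in> \<rat>)"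
proof
  assume *: "\<forall>n. coeff (linear_factors xs) n \<in> \<rat>"
  show "\<forall>k. power_sum xs k \<in> \<rat>"
  proof
    fix k
    show "power_sum xs k \<in> \<rat>"
    proof (cases k)
      case (Suc n)
      then show ?thesis
        using * by (auto simp only: Rats_0 Rats_1 intro: power_sum_closed Rats_diff Rats_mult)
    qed simp
  qed
next
  assume "\<forall>k. power_sum xs k \<in> \<rat>"
  then have "(- Abs_fps (\<lambda>n. power_sum xs (Suc n))) $ n \<in> \<rat>" for n
    by simp
  then have "reversed_factors xs $ n \<in> \<rat>" for n
    by (rule fps_ode_rational[OF fps_deriv_reversed_factors, rotated]) simp
  then show "\<forall>n. coeff (linear_factors xs) n \<in> \<rat>"
    using coeffs_reversed_iff[of \<rat> xs] by simp
qed

section \<open>Algebraic numbers form a ring\<close>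

text \<open>
  The list witnessing algebraicity consists of all roots of an annihilating polynomial, with multiplicity. In this form
  algebraicity can be combined: instead of finding a polynomial for \<open>x + y\<close>, it suffices to exhibit a list
  containing \<open>x + y\<close> and to compute its power sums.
\<close>
lemma algebraic_iff_rational_power_sums:
  "algebraic z \<longleftrightarrow> (\<exists>xs. z \<in> set xs \<and> (\<forall>k. power_sum xs k \<in> \<rat>))"
proof
  assume "algebraic z"
  then obtain p where p: "\<And>i. coeff p i \<in> \<rat>" "p \<noteq> 0" "poly p z = 0"
    unfolding algebraic_altdef by blast
  obtain A where A: "p = smult (lead_coeff p) (\<Prod>x\<in>#A. [:- x, 1:])"
    using alg_closed_imp_factorization[OF p(2)] by metis
  obtain xs where "A = mset xs"
    by (metis ex_mset)
  with A have xs: "p = smult (lead_coeff p) (linear_factors xs)"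
    by (simp add: linear_factors_def flip: mset_map prod_mset_prod_list)
  define l where "l = lead_coeff p"
  have "l \<noteq> 0" "l \<in> \<rat>" and xs: "p = smult l (linear_factors xs)"
    using p(1,2) xs by (simp_all add: l_def)
  then have "coeff (linear_factors xs) n = coeff p n / l" for n
    by simp
  then have "\<forall>n. coeff (linear_factors xs) n \<in> \<rat>"
    using p(1) \<open>l \<in> \<rat>\<close> by simp
  moreover have "poly (linear_factors xs) z = 0"
    using p(3) \<open>l \<noteq> 0\<close> by (simp add: xs)
  ultimately show "\<exists>xs. z \<in> set xs \<and> (\<forall>k. power_sum xs k \<in> \<rat>)"
    using rational_coeffs_iff_power_sums poly_linear_factors_eq_0_iff by blast
next
  assume "\<exists>xs. z \<in> set xs \<and> (\<forall>k. power_sum xs k \<in> \<rat>)"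
  then obtain xs where z: "z \<in> set xs" and xs: "\<forall>k. power_sum xs k \<in> \<rat>" by blast
  show "algebraic z"
  proof (rule algebraicI')
    show "coeff (linear_factors xs) i \<in> \<rat>" for i
      using xs rational_coeffs_iff_power_sums by blast
    show "poly (linear_factors xs) z = 0"
      using z by (simp only: poly_linear_factors_eq_0_iff)
  qed (rule linear_factors_nonzero)
qed

lemma power_sum_concat_sums:
  "power_sum (concat (map (\<lambda>x. map ((+) x) ys) xs)) k =
     (\<Sum>j\<le>k. of_nat (k choose j) * (power_sum xs j * power_sum ys (k - j)))"
proof (induction xs)
  case (Cons x xs)
  have "power_sum (map ((+) x) ys) k = (\<Sum>j\<le>k. of_nat (k choose j) * (x ^ j * power_sum ys (k - j)))"
    by (induction ys) (simp_all add: binomial_ring sum.distrib ring_distribs mult.assoc)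
  with Cons show ?case
    by (simp add: sum.distrib ring_distribs)
qed simp

lemma power_sum_concat_products:
  "power_sum (concat (map (\<lambda>x. map ((*) x) ys) xs)) k = power_sum xs k * power_sum ys k"
  by (induction xs) (simp_all add: power_sum_map_mult ring_distribs)

lemma algebraic_add:
  fixes x y :: complex
  assumes "algebraic x" "algebraic y"
  shows "algebraic (x + y)"
proof -
  obtain xs ys where "x \<in> set xs" "y \<in> set ys"
    and rat: "\<And>k. power_sum xs k \<in> \<rat>" "\<And>k. power_sum ys k \<in> \<rat>"
    using assms unfolding algebraic_iff_rational_power_sums by blast
  then have "x + y \<in> set (concat (map (\<lambda>x. map ((+) x) ys) xs))" by auto
  moreover have "power_sum (concat (map (\<lambda>x. map ((+) x) ys) xs)) k \<in> \<rat>" for k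
    unfolding power_sum_concat_sums using rat by (intro Rats_sum Rats_mult) auto
  ultimately show ?thesis
    unfolding algebraic_iff_rational_power_sums by blast
qed

lemma algebraic_mult:
  fixes x y :: complex
  assumes "algebraic x" "algebraic y"
  shows "algebraic (x * y)"
proof -
  obtain xs ys where "x \<in> set xs" "y \<in> set ys"
    and rat: "\<And>k. power_sum xs k \<in> \<rat>" "\<And>k. power_sum ys k \<in> \<rat>"
    using assms unfolding algebraic_iff_rational_power_sums by blast
  then have "x * y \<in> set (concat (map (\<lambda>x. map ((*) x) ys) xs))" by auto
  moreover have "power_sum (concat (map (\<lambda>x. map ((*) x) ys) xs)) k \<in> \<rat>" for k
    unfolding power_sum_concat_products using rat by (intro Rats_mult)
  ultimately show ?thesis
    unfolding algebraic_iff_rational_power_sums by blast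
qed

section \<open>Subset sums of the roots\<close>

text \<open>
  Expanding \<open>\<Prod>(1 + exp x)\<close> produces one exponential for each sublist; repeated sums are listed with
  multiplicity.
\<close>
primrec subset_sums :: "complex list \<Rightarrow> complex list" where
  "subset_sums [] = [0]"
| "subset_sums (x # xs) = subset_sums xs @ map ((+) x) (subset_sums xs)"

lemma zero_in_subset_sums: "0 \<in> set (subset_sums xs)"
  by (induction xs) auto

lemma sum_exp_subset_sums: "(\<Sum>s\<leftarrow>subset_sums xs. exp s) = (\<Prod>x\<leftarrow>xs. 1 + exp x)"
proof (induction xs)
  case (Cons x xs)
  have "(\<Sum>s\<leftarrow>subset_sums xs. exp (x + s)) = exp x * (\<Sum>s\<leftarrow>subset_sums xs. exp s)"
    by (simp add: exp_add sum_list_const_mult)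
  with Cons.IH show ?case by (simp add: o_def ring_distribs)
qed simp

lemma nth_sum_fps_exp: "(\<Sum>x\<leftarrow>xs. fps_exp x) $ n = power_sum xs n / fact n"
  by (induction xs) (simp_all add: add_divide_distrib)

lemma sum_fps_exp_subset_sums:
  "(\<Sum>s\<leftarrow>subset_sums xs. fps_exp s) = (\<Prod>x\<leftarrow>xs. 1 + fps_exp x)"
proof (induction xs)
  case (Cons x xs)
  have "(\<Sum>s\<leftarrow>subset_sums xs. fps_exp (x + s)) = fps_exp x * (\<Sum>s\<leftarrow>subset_sums xs. fps_exp s)"
    by (simp add: fps_exp_add_mult sum_list_const_mult)
  with Cons.IH show ?case by (simp add: o_def ring_distribs)
qed simp

text \<open>
  Here \<open>h\<close> is the fixed rational series \<open>e\<^sup>X / (1 + e\<^sup>X)\<close>. The logarithmic derivative of \<open>1 + exp (x X)\<close> is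
  \<open>x h (x X)\<close>, so summing over the list turns the \<open>n\<close>-th coefficient \<open>h\<^sub>n\<close> into \<open>h\<^sub>n\<close> times a power sum.
\<close>
lemma fps_deriv_prod_exp:
  assumes h: "h * (1 + fps_exp 1) = fps_exp (1 :: complex)"
  shows "fps_deriv (\<Prod>x\<leftarrow>xs. 1 + fps_exp x) =
    Abs_fps (\<lambda>n. h $ n * power_sum xs (Suc n)) * (\<Prod>x\<leftarrow>xs. 1 + fps_exp x)"
proof (induction xs)
  case (Cons x xs)
  let ?P = "\<Prod>x\<leftarrow>xs. 1 + fps_exp x" and ?G = "Abs_fps (\<lambda>n. h $ n * power_sum xs (Suc n))"
  let ?g = "Abs_fps (\<lambda>n. h $ n * x ^ Suc n)"
  have g: "?g * (1 + fps_exp x) = fps_const x * fps_exp x"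
  proof (rule fps_ext)
    fix n
    have "(1 + fps_exp x) $ k = x ^ k * (1 + fps_exp 1) $ k" for k
      by (cases k) simp_all
    then have "(?g * (1 + fps_exp x)) $ n =
        (\<Sum>i=0..n. x ^ Suc i * x ^ (n - i) * (h $ i * (1 + fps_exp 1) $ (n - i)))"
      unfolding fps_mult_nth by (intro sum.cong) (simp_all add: mult_ac)
    also have "\<dots> = (\<Sum>i=0..n. x ^ Suc n * (h $ i * (1 + fps_exp 1) $ (n - i)))"
      by (intro sum.cong) (simp_all flip: power_add)
    also have "\<dots> = x ^ Suc n * (h * (1 + fps_exp 1)) $ n"
      by (simp only: fps_mult_nth sum_distrib_left)
    also have "\<dots> = (fps_const x * fps_exp x) $ n"
      unfolding h by simp
    finally show "(?g * (1 + fps_exp x)) $ n = (fps_const x * fps_exp x) $ n" .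
  qed
  have "Abs_fps (\<lambda>n. h $ n * power_sum (x # xs) (Suc n)) = ?g + ?G"
    by (simp add: fps_eq_iff ring_distribs)
  then have "Abs_fps (\<lambda>n. h $ n * power_sum (x # xs) (Suc n)) * (\<Prod>x\<leftarrow>x # xs. 1 + fps_exp x)
    = (?g * (1 + fps_exp x)) * ?P + (1 + fps_exp x) * (?G * ?P)"
    by (simp add: algebra_simps)
  also have "\<dots> = fps_deriv (\<Prod>x\<leftarrow>x # xs. 1 + fps_exp x)"
    unfolding g Cons.IH[symmetric] by simp
  finally show ?case by simp
qed (simp add: fps_eq_iff fps_mult_nth)

text \<open>
  The exponential generating function of the power sums of all subset sums is \<open>\<Prod>(1 + exp (x X))\<close>. It solves a linear
  differential equation whose coefficients involve only the power sums of the original list.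
\<close>
lemma power_sum_subset_sums_rational:
  assumes "\<And>k. power_sum xs k \<in> \<rat>"
  shows "power_sum (subset_sums xs) k \<in> \<rat>"
proof -
  let ?e = "fps_exp 1 :: complex fps"
  define h where "h = ?e * inverse (1 + ?e)"
  have h: "h * (1 + ?e) = ?e"
    unfolding h_def by (simp add: mult.assoc inverse_mult_eq_1)
  have h_rat: "h $ n \<in> \<rat>" for n
  \<comment> \<open>The factor \<open>1/2\<close> normalises the constant coefficient of \<open>1 + e\<^sup>X\<close> to \<open>1\<close>.\<close>
  proof (rule fps_quotient_closed[where F = "fps_const (1/2) * (1 + ?e)" and H = "fps_const (1/2) * ?e"])
    show "h * (fps_const (1/2) * (1 + ?e)) = fps_const (1/2) * ?e"
      using h by (metis mult.left_commute)
    have fact: "(fact k :: complex) \<in> \<rat>" for k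
      by (metis Rats_of_nat of_nat_fact)
    show "(fps_const (1/2) * (1 + ?e)) $ n \<in> \<rat>" "(fps_const (1/2) * ?e) $ n \<in> \<rat>" for n
      using fact by (cases n; simp; fail)+
  qed auto
  let ?F = "\<Sum>s\<leftarrow>subset_sums xs. fps_exp s"
  have "?F $ k \<in> \<rat>"
  proof (rule fps_ode_rational)
    show "fps_deriv ?F = Abs_fps (\<lambda>n. h $ n * power_sum xs (Suc n)) * ?F"
      unfolding sum_fps_exp_subset_sums by (rule fps_deriv_prod_exp[OF h])
    show "?F $ 0 \<in> \<rat>"
      by (simp add: nth_sum_fps_exp)
    show "Abs_fps (\<lambda>n. h $ n * power_sum xs (Suc n)) $ n \<in> \<rat>" for n
      using h_rat assms by simp
  qed
  then have "fact k * (power_sum (subset_sums xs) k / fact k) \<in> \<rat>"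
    unfolding nth_sum_fps_exp by (metis Rats_mult Rats_of_nat of_nat_fact)
  then show ?thesis by simp
qed

lemma reversed_factors_scale:
  "reversed_factors (map ((*) c) xs) $ n = c ^ n * reversed_factors xs $ n"
proof (induction xs arbitrary: n)
  case Nil
  then show ?case by (cases n) simp_all
next
  case (Cons x xs)
  have step: "((1 - fps_const a * fps_X) * f) $ n = f $ n - (if n = 0 then 0 else a * f $ (n - 1))"
    for a :: complex and f n
    by (cases n) (simp_all add: left_diff_distrib mult.assoc)
  show ?case
    unfolding list.map reversed_factors_simps step Cons.IH
    by (cases n) (simp_all add: algebra_simps)
qed

lemma common_denominator:
  assumes "finite A" "A \<subseteq> \<rat>"
  shows "\<exists>c::nat. c > 0 \<and> (\<forall>a\<in>A. of_nat c * a \<in> (\<int> :: complex set))"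
  using assms
proof (induction A rule: finite_induct)
  case (insert a A)
  then obtain c :: nat where c: "c > 0" "\<forall>b\<in>A. of_nat c * b \<in> (\<int> :: complex set)" by auto
  obtain m n where n: "n > 0" "a = of_int m / of_int n"
    using insert.prems by (auto elim: Rats_cases')
  have "of_nat (nat n * c) * b \<in> \<int>" if "b \<in> insert a A" for b
  proof (cases "b = a")
    case True
    have "of_nat (nat n * c) * a = of_int (m * int c)"
      using n by simp
    then show ?thesis using True by (metis Ints_of_int)
  next
    case False
    with that have "of_nat c * b \<in> \<int>" using c(2) by blast
    from Ints_mult[OF Ints_of_int this, of n]
    have "of_int n * (of_nat c * b) \<in> \<int>" .
    moreover have "of_nat (nat n * c) * b = of_int n * (of_nat c * b)"
      using of_int_of_nat_eq[of "nat n", where 'a = complex] n(1) by (simp add: mult.assoc)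
    ultimately show ?thesis by (simp only:)
  qed
  then show ?case using n c by (metis nat_0_less_mult_iff zero_less_nat_eq)
qed (use zero_less_one in blast)

text \<open>
  Scaling the roots by \<open>c\<close> multiplies the \<open>n\<close>-th reversed coefficient by \<open>c\<^sup>n\<close>. A common denominator
  \<open>c\<close> of all coefficients is enough, because the leading coefficient \<open>1\<close> (the case \<open>n = 0\<close>) is already integral.
\<close>
lemma scaled_linear_factors_integral:
  assumes "\<And>k. power_sum xs k \<in> \<rat>"
  shows "\<exists>c::nat. c > 0 \<and> (\<forall>n. coeff (linear_factors (map ((*) (of_nat c)) xs)) n \<in> \<int>)"
proof -
  let ?F = "reversed_factors xs" and ?d = "degree (reflect_poly (linear_factors xs))"
  have rat: "?F $ n \<in> \<rat>" for n
    using assms rational_coeffs_iff_power_sums[of xs] coeffs_reversed_iff[of \<rat> xs] by simp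
  then obtain c :: nat where c: "c > 0" "\<And>n. n \<le> ?d \<Longrightarrow> of_nat c * ?F $ n \<in> \<int>"
    using common_denominator[of "fps_nth ?F ` {..?d}"] by auto
  have "reversed_factors (map ((*) (of_nat c)) xs) $ n \<in> \<int>" for n
  proof (cases "n = 0 \<or> n > ?d")
    case True
    then have "n = 0 \<or> ?F $ n = 0"
      by (auto simp: reversed_factors_nth coeff_eq_0)
    then show ?thesis
      by (auto simp: reversed_factors_scale)
  next
    case False
    then have "of_nat c * ?F $ n \<in> \<int>"
      using c(2) by simp
    from Ints_mult[OF Ints_power[OF Ints_of_nat, of c "n - 1"] this] False show ?thesis
      by (cases n) (simp_all add: reversed_factors_scale mult_ac)
  qed
  then have "\<forall>n. coeff (linear_factors (map ((*) (of_nat c)) xs)) n \<in> \<int>"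
    using coeffs_reversed_iff[OF Ints_0] by blast
  then show ?thesis
    using c(1) by blast
qed

section \<open>Transcendence of \<open>\<pi>\<close>\<close>

lemma coeff_pcompose_shift:
  fixes P :: "complex poly"
  shows "coeff (pcompose P [:g, 1:]) k =
    (\<Sum>n\<le>degree P. coeff P n * (of_nat (n choose k) * g ^ (n - k)))"
proof -
  have lin: "coeff ([:g, 1:] ^ n) k = of_nat (n choose k) * g ^ (n - k)" for n
  proof (cases "k \<le> n")
    case False
    then show ?thesis
      by (simp add: coeff_eq_0 degree_linear_power)
  qed (simp add: coeff_linear_poly_power)
  have "pcompose P [:g, 1:] = (\<Sum>n\<le>degree P. smult (coeff P n) ([:g, 1:] ^ n))"
    by (simp add: pcompose_altdef poly_altdef degree_map_poly coeff_map_poly)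
  then show ?thesis by (simp add: coeff_sum lin)
qed

text \<open>
  For \<open>f(x) = P(c x)\<close> this is the sum of all derivatives \<open>f\<^sup>(\<^sup>k\<^sup>)\<close> at the point \<open>g / c\<close>, Hermite's
  function with \<open>e\<^sup>z\<close> times its value at \<open>0\<close> close to its value at \<open>z\<close>. Derivatives are written as \<open>k!\<close> times a
  Taylor coefficient of \<open>P\<close> at \<open>g\<close>, which displays their divisibility by factorials, and the
  scaling by \<open>c\<close> allows \<open>P\<close> and \<open>g\<close> to be integral.
\<close>
definition hermite_sum :: "complex \<Rightarrow> complex poly \<Rightarrow> complex \<Rightarrow> complex" where
  "hermite_sum c P g = (\<Sum>k\<le>degree P. fact k * (c ^ k * coeff (pcompose P [:g, 1:]) k))"

text \<open>
  Each monomial contributes a truncated exponential series; this is what makes the approximation of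
  \<open>exp (g / c)\<close> visible.
\<close>
lemma hermite_sum_monomials:
  assumes c: "c \<noteq> 0"
  shows "hermite_sum c P g =
    (\<Sum>n\<le>degree P. coeff P n * (fact n * c ^ n * (\<Sum>j\<le>n. (g / c) ^ j / fact j)))"
proof -
  have inner: "(\<Sum>k\<le>degree P. fact k * c ^ k * (of_nat (n choose k) * g ^ (n - k))) =
      fact n * c ^ n * (\<Sum>j\<le>n. (g / c) ^ j / fact j)" if n: "n \<le> degree P" for n
  proof -
    have "(\<Sum>k\<le>degree P. fact k * c ^ k * (of_nat (n choose k) * g ^ (n - k))) =
        (\<Sum>k\<le>n. fact k * c ^ k * (of_nat (n choose k) * g ^ (n - k)))"
      using n by (intro sum.mono_neutral_right) auto
    \<comment> \<open>Index by the exponent \<open>j = n - k\<close> of \<open>g\<close>.\<close>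
    also have "\<dots> = (\<Sum>j\<le>n. fact (n - j) * c ^ (n - j) * (of_nat (n choose (n - j)) * g ^ (n - (n - j))))"
      by (rule sum.reindex_bij_witness[of _ "\<lambda>j. n - j" "\<lambda>j. n - j"]) auto
    also have "\<dots> = (\<Sum>j\<le>n. fact n * c ^ n * ((g / c) ^ j / fact j))"
    proof (rule sum.cong)
      fix j assume "j \<in> {..n}"
      then have j: "j \<le> n" by simp
      have "(of_nat (n choose (n - j)) :: complex) * fact (n - j) = fact n / fact j"
        using binomial_fact[of "n - j" n, where 'a = complex] j by simp
      moreover have "c ^ (n - j) = c ^ n / c ^ j"
        using c j by (simp add: power_diff)
      ultimately show "fact (n - j) * c ^ (n - j) * (of_nat (n choose (n - j)) * g ^ (n - (n - j))) =
          fact n * c ^ n * ((g / c) ^ j / fact j)"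
        using j by (simp add: power_divide mult_ac)
    qed simp
    finally show ?thesis by (simp add: sum_distrib_left)
  qed
  have "hermite_sum c P g =
     (\<Sum>k\<le>degree P. \<Sum>n\<le>degree P. coeff P n * (fact k * c ^ k * (of_nat (n choose k) * g ^ (n - k))))"
    unfolding hermite_sum_def coeff_pcompose_shift sum_distrib_left by (simp add: mult_ac)
  also have "\<dots> = (\<Sum>n\<le>degree P. coeff P n *
      (\<Sum>k\<le>degree P. fact k * c ^ k * (of_nat (n choose k) * g ^ (n - k))))"
    by (subst sum.swap) (simp add: sum_distrib_left)
  also have "\<dots> = (\<Sum>n\<le>degree P. coeff P n * (fact n * c ^ n * (\<Sum>j\<le>n. (g / c) ^ j / fact j)))"
    by (intro sum.cong refl arg_cong2[where f = "(*)"] inner) simp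
  finally show ?thesis .
qed

text \<open>
  Taylor's remainder for a truncated exponential of length \<open>n\<close> carries the factor \<open>1 / n!\<close>, which cancels the
  factor \<open>n!\<close> in front of the monomial. What remains is bounded by \<open>P\<close> with absolute values on its coefficients.
\<close>
lemma hermite_sum_approx:
  assumes c: "c \<noteq> 0"
  shows "norm (hermite_sum c P g - exp (g / c) * hermite_sum c P 0) \<le>
    norm (g / c) * exp (norm (g / c)) * (\<Sum>n\<le>degree P. norm (coeff P n) * norm g ^ n)"
proof -
  let ?z = "g / c"
  have T0: "hermite_sum c P 0 = (\<Sum>n\<le>degree P. coeff P n * (fact n * c ^ n))"
    by (simp add: hermite_sum_def mult_ac)
  have "norm (hermite_sum c P g - exp ?z * hermite_sum c P 0) =
      norm (\<Sum>n\<le>degree P. coeff P n * (fact n * c ^ n) * ((\<Sum>j\<le>n. ?z ^ j / fact j) - exp ?z))"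
    unfolding hermite_sum_monomials[OF c, of P g] T0
    by (simp add: sum_distrib_left sum_subtractf algebra_simps)
  also have "\<dots> \<le> (\<Sum>n\<le>degree P. norm ?z * exp (norm ?z) * (norm (coeff P n) * norm g ^ n))"
  proof (rule sum_norm_le)
    fix n
    have "norm (coeff P n * (fact n * c ^ n) * ((\<Sum>j\<le>n. ?z ^ j / fact j) - exp ?z)) =
        norm (coeff P n) * (fact n * norm c ^ n) * norm (exp ?z - (\<Sum>j\<le>n. ?z ^ j / fact j))"
      by (simp add: norm_mult norm_power norm_minus_commute)
    also have "\<dots> \<le> norm (coeff P n) * (fact n * norm c ^ n) * (exp (norm ?z) * norm ?z ^ Suc n / fact n)"
      by (intro mult_left_mono Taylor_exp_field[THEN order_trans]) auto
    also have "\<dots> = norm ?z * exp (norm ?z) * (norm (coeff P n) * norm g ^ n)"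
      using c by (simp add: norm_divide power_divide field_simps)
    finally show "norm (coeff P n * (fact n * c ^ n) * ((\<Sum>j\<le>n. ?z ^ j / fact j) - exp ?z))
        \<le> norm ?z * exp (norm ?z) * (norm (coeff P n) * norm g ^ n)" .
  qed
  also have "\<dots> = norm ?z * exp (norm ?z) * (\<Sum>n\<le>degree P. norm (coeff P n) * norm g ^ n)"
    by (rule sum_distrib_left[symmetric])
  finally show ?thesis .
qed

text \<open>
  A majorant relation that is stable under products; it bounds the sum of absolute values of the terms
  of a power \<open>P\<^sup>n\<close> by an \<open>n\<close>-th power.
\<close>
definition dominated :: "complex poly \<Rightarrow> real poly \<Rightarrow> bool" where
  "dominated P Q \<longleftrightarrow> (\<forall>n. norm (coeff P n) \<le> coeff Q n)"

lemma dominated_mult: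
  assumes "dominated P Q" "dominated P' Q'"
  shows "dominated (P * P') (Q * Q')"
  unfolding dominated_def
proof
  fix n
  have "norm (coeff (P * P') n) \<le> (\<Sum>i\<le>n. norm (coeff P i) * norm (coeff P' (n - i)))"
    unfolding coeff_mult by (intro sum_norm_le) (simp add: norm_mult)
  also have "\<dots> \<le> coeff (Q * Q') n"
    unfolding coeff_mult using assms norm_ge_zero order_trans
    by (intro sum_mono mult_mono) (auto simp: dominated_def intro: order_trans[OF norm_ge_zero])
  finally show "norm (coeff (P * P') n) \<le> coeff (Q * Q') n" .
qed

lemma dominated_power: "dominated P Q \<Longrightarrow> dominated (P ^ n) (Q ^ n)"
  by (induction n) (auto simp: dominated_mult, simp add: dominated_def)

lemma dominated_sum_le_poly:
  assumes "dominated P Q" "r \<ge> 0"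
  shows "(\<Sum>n\<le>degree P. norm (coeff P n) * r ^ n) \<le> poly Q r"
proof -
  have nonneg: "coeff Q n \<ge> 0" for n
    using assms(1) norm_ge_zero order_trans unfolding dominated_def by blast
  have "(\<Sum>n\<le>degree P. norm (coeff P n) * r ^ n) \<le> (\<Sum>n\<le>degree P. coeff Q n * r ^ n)"
    using assms by (intro sum_mono mult_right_mono) (auto simp: dominated_def)
  also have "\<dots> \<le> (\<Sum>n\<le>max (degree P) (degree Q). coeff Q n * r ^ n)"
    using nonneg assms(2) by (intro sum_mono2) auto
  also have "\<dots> = poly Q r"
    unfolding poly_altdef by (intro sum.mono_neutral_right) (auto simp: coeff_eq_0)
  finally show ?thesis .
qed

lemma coeff_mult_Ints:
  assumes "\<forall>n. coeff P n \<in> \<int>" "\<forall>n. coeff Q n \<in> \<int>"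
  shows "\<forall>n. coeff (P * Q) n \<in> \<int>"
  using assms by (auto simp: coeff_mult intro!: Ints_sum Ints_mult)

lemma coeff_power_Ints: "\<forall>n. coeff P n \<in> \<int> \<Longrightarrow> \<forall>n. coeff (P ^ k) n \<in> \<int>"
  by (induction k) (simp_all add: coeff_mult_Ints)

text \<open>
  All terms with \<open>k > q\<close> carry an extra factor \<open>q + 1\<close>. With \<open>q + 1\<close> prime, nonvanishing of
  the sum can be read off from \<open>t q\<close> modulo \<open>q + 1\<close>.
\<close>
lemma sum_fact_mod:
  fixes t :: "nat \<Rightarrow> complex"
  assumes int: "\<And>k. t k \<in> \<int>" and zero: "\<And>k. k < q \<Longrightarrow> t k = 0" and "q \<le> N"
  shows "\<exists>a. (\<Sum>k\<le>N. fact k * t k) = fact q * (t q + of_nat (Suc q) * of_int a)"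
  using \<open>q \<le> N\<close>
proof (induction N rule: dec_induct)
  case base
  have "(\<Sum>k\<le>q. fact k * t k) = (\<Sum>k\<in>{q}. fact k * t k)"
    using zero by (intro sum.mono_neutral_right) auto
  then show ?case by (intro exI[of _ 0]) simp
next
  case (step N)
  then obtain a where a: "(\<Sum>k\<le>N. fact k * t k) = fact q * (t q + of_nat (Suc q) * of_int a)" by blast
  obtain b where b: "t (Suc N) = of_int b" using int Ints_cases by blast
  have "fact (Suc q) dvd (fact (Suc N) :: nat)"
    using step by (intro fact_dvd) auto
  then obtain d where "fact (Suc N) = fact (Suc q) * (d :: nat)" by blast
  then have "(fact (Suc N) :: complex) = of_nat (Suc q) * fact q * of_nat d"
    by (metis fact_Suc of_nat_fact of_nat_mult)
  then have "(\<Sum>k\<le>Suc N. fact k * t k) = fact q * (t q + of_nat (Suc q) * of_int (a + int d * b))"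
    by (simp add: a b algebra_simps del: of_nat_Suc fact_Suc)
  then show ?case by blast
qed

text \<open>
  A single Taylor coefficient at a root is only an algebraic number, but the sum over all roots is an integral
  combination of power sums.
\<close>
lemma sum_coeff_shift_Ints:
  assumes "\<forall>n. coeff P n \<in> \<int>" "\<And>k. power_sum gs k \<in> \<int>"
  shows "(\<Sum>g\<leftarrow>gs. coeff (pcompose P [:g, 1:]) k) \<in> \<int>"
proof -
  have "(\<Sum>g\<leftarrow>gs. coeff (pcompose P [:g, 1:]) k) =
      (\<Sum>n\<le>degree P. coeff P n * (of_nat (n choose k) * power_sum gs (n - k)))"
    by (induction gs) (simp_all add: coeff_pcompose_shift ring_distribs sum.distrib)
  also have "\<dots> \<in> \<int>"
    using assms by (intro Ints_sum Ints_mult) auto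
  finally show ?thesis .
qed

lemma norm_sum_list_le:
  assumes "\<And>x. x \<in> set xs \<Longrightarrow> norm (f x :: complex) \<le> b x"
  shows "norm (\<Sum>x\<leftarrow>xs. f x) \<le> (\<Sum>x\<leftarrow>xs. b x)"
  using assms by (induction xs) (auto intro!: norm_triangle_mono)

text \<open>
  Let \<open>G\<close> be the monic integral polynomial with roots \<open>gs\<close>, let \<open>p = q + 1\<close> be a large prime and take
  \<open>P = X\<^sup>q G\<^sup>p\<close>. Form \<open>K\<close> times Hermite's sum at \<open>0\<close> plus the Hermite sums at all the roots. Each root is
  a zero of \<open>P\<close> of order \<open>p\<close>, and \<open>0\<close> is a zero of order exactly \<open>q\<close>, so this total is \<open>q!\<close> times an
  integer congruent to \<open>K c\<^sup>q G(0)\<^sup>p\<close> modulo \<open>p\<close>, which is nonzero for \<open>p\<close> large. Under the assumed relation between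
  exponentials the total is also a sum of approximation errors, hence of geometric growth in \<open>q\<close>, and it
  cannot keep up with \<open>q!\<close>.
\<close>
lemma sum_exp_integral_roots_nonzero:
  fixes gs :: "complex list" and c K :: nat
  assumes int: "\<forall>n. coeff (linear_factors gs) n \<in> \<int>"
    and nz: "0 \<notin> set gs" and "c > 0" "K > 0"
  shows "of_nat K + (\<Sum>g\<leftarrow>gs. exp (g / of_nat c)) \<noteq> 0"
proof
  assume rel: "of_nat K + (\<Sum>g\<leftarrow>gs. exp (g / of_nat c)) = 0"
  define G where "G = linear_factors gs"
  define C :: complex where "C = of_nat c"
  have C: "C \<noteq> 0" using \<open>c > 0\<close> by (simp add: C_def)
  have ps: "power_sum gs k \<in> \<int>" for k
  proof (cases k)
    case (Suc n)
    then show ?thesis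
      using int by (auto simp only: Ints_0 Ints_1 intro: power_sum_closed Ints_diff Ints_mult)
  qed simp
  obtain m where m: "coeff G 0 = of_int m"
    using int Ints_cases unfolding G_def by blast
  have "poly G 0 \<noteq> 0"
    using nz by (simp add: G_def poly_linear_factors_eq_0_iff)
  then have "m \<noteq> 0" using m by (simp add: poly_0_coeff_0)
  define Q where "Q = map_poly norm G"
  have dom: "dominated G Q"
    by (simp add: dominated_def Q_def coeff_map_poly)
  define E where "E = (\<Sum>g\<leftarrow>gs. norm (g / C) * exp (norm (g / C)))"
  define B where "B = 1 + (\<Sum>g\<leftarrow>gs. norm g) + (\<Sum>g\<leftarrow>gs. poly Q (norm g))"
  have Q_nonneg: "poly Q r \<ge> 0" if "r \<ge> 0" for r
    using that by (simp add: poly_altdef Q_def coeff_map_poly sum_nonneg)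
  have B: "norm g \<le> B" "poly Q (norm g) \<le> B" if "g \<in> set gs" for g
  proof -
    have "norm g \<le> (\<Sum>g\<leftarrow>gs. norm g)" "poly Q (norm g) \<le> (\<Sum>g\<leftarrow>gs. poly Q (norm g))"
      using that by (auto intro!: member_le_sum_list Q_nonneg)
    moreover have "(\<Sum>g\<leftarrow>gs. norm g) \<ge> 0" "(\<Sum>g\<leftarrow>gs. poly Q (norm g)) \<ge> 0"
      by (auto intro!: sum_list_nonneg Q_nonneg)
    ultimately show "norm g \<le> B" "poly Q (norm g) \<le> B"
      by (simp_all add: B_def)
  qed
  have "B \<ge> 1"
    unfolding B_def by (auto intro!: sum_list_nonneg Q_nonneg add_nonneg_nonneg)
  \<comment> \<open>The lower bound comes from divisibility, the upper bound from \<open>hermite_sum_approx\<close>.\<close>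
  have lower_upper: "fact q \<le> E * B * (B ^ 2) ^ q"
    if p: "prime (Suc q)" "Suc q > K" "Suc q > c" "Suc q > nat \<bar>m\<bar>" for q
  proof -
    define P where "P = monom 1 q * G ^ Suc q"
    have P_int: "\<forall>n. coeff P n \<in> \<int>"
      unfolding P_def G_def using int by (intro coeff_mult_Ints coeff_power_Ints) auto
    have "G \<noteq> 0" by (simp add: G_def)
    then have "q \<le> degree P"
      by (simp add: P_def degree_mult_eq degree_monom_eq)
    \<comment> \<open>The total is \<open>\<Sum>k! t k\<close>, so \<open>sum_fact_mod\<close> applies to all points at once.\<close>
    define t where "t k = of_nat K * (C ^ k * coeff P k) +
        C ^ k * (\<Sum>g\<leftarrow>gs. coeff (pcompose P [:g, 1:]) k)" for k
    have t_int: "t k \<in> \<int>" for k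
      unfolding t_def C_def using P_int sum_coeff_shift_Ints[OF P_int ps]
      by (intro Ints_add Ints_mult Ints_power) auto
    have shift_zero: "(\<Sum>g\<leftarrow>gs. coeff (pcompose P [:g, 1:]) k) = 0" if "k \<le> q" for k
    proof -
      have "coeff (pcompose P [:g, 1:]) k = 0" if "g \<in> set gs" for g
      proof -
        have "poly G g = 0"
          using that by (simp add: G_def poly_linear_factors_eq_0_iff)
        then obtain H where "G = [:- g, 1:] * H"
          using poly_eq_0_iff_dvd by (metis dvdE)
        then have "pcompose G [:g, 1:] = monom 1 1 * pcompose H [:g, 1:]"
          by (simp only: pcompose_mult) (simp add: pcompose_pCons monom_altdef)
        moreover have "pcompose (G ^ n) [:g, 1:] = pcompose G [:g, 1:] ^ n" for n
          by (induction n) (simp_all add: pcompose_mult pcompose_1)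
        ultimately have "pcompose P [:g, 1:] = monom 1 (Suc q) *
            (pcompose (monom 1 q) [:g, 1:] * pcompose H [:g, 1:] ^ Suc q)"
          unfolding P_def pcompose_mult by (simp add: power_mult_distrib monom_power mult_ac del: power_Suc)
        then show ?thesis
          using \<open>k \<le> q\<close> by (simp add: coeff_monom_mult)
      qed
      then show ?thesis by (simp add: sum_list_0 cong: map_cong)
    qed
    have coeff_low: "coeff P k = (if k = q then of_int m ^ Suc q else 0)" if "k \<le> q" for k
      using that m by (auto simp: P_def coeff_monom_mult coeff_0_power simp del: power_Suc)
    have "t k = 0" if "k < q" for k
      using that by (simp add: t_def shift_zero coeff_low)
    then obtain a where a: "(\<Sum>k\<le>degree P. fact k * t k) = fact q * (t q + of_nat (Suc q) * of_int a)"
      using sum_fact_mod[of t q "degree P"] t_int \<open>q \<le> degree P\<close> by blast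
    define b where "b = int K * (int c ^ q * m ^ Suc q) + int (Suc q) * a"
    have total: "(\<Sum>k\<le>degree P. fact k * t k) = fact q * of_int b"
      unfolding a b_def by (simp add: t_def shift_zero coeff_low C_def)
    have "b \<noteq> 0"
    proof
      assume "b = 0"
      then have "int (Suc q) dvd int K * (int c ^ q * m ^ Suc q)"
        unfolding b_def by (metis add_eq_0_iff dvd_minus_iff dvd_triv_left)
      moreover have "prime (int (Suc q))" using p(1) by (simp only: prime_nat_int_transfer)
      ultimately have "int (Suc q) dvd int K \<or> int (Suc q) dvd int c \<or> int (Suc q) dvd m"
        by (metis prime_dvd_mult_iff prime_dvd_power)
      then have "int (Suc q) \<le> int K \<or> int (Suc q) \<le> int c \<or> int (Suc q) \<le> \<bar>m\<bar>"
        using \<open>K > 0\<close> \<open>c > 0\<close> \<open>m \<noteq> 0\<close> by (metis dvd_abs_iff of_nat_0_less_iff zdvd_imp_le zero_less_abs_iff)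
      then show False using p(2,3,4) by linarith
    qed
    have "(fact q :: real) \<le> fact q * real_of_int \<bar>b\<bar>"
      using \<open>b \<noteq> 0\<close> by simp
    also have "\<dots> = norm (\<Sum>k\<le>degree P. fact k * t k)"
      unfolding total by (simp add: norm_mult)
    also have "(\<Sum>k\<le>degree P. fact k * t k) =
        of_nat K * hermite_sum C P 0 + (\<Sum>g\<leftarrow>gs. hermite_sum C P g)"
    proof -
      have "(\<Sum>g\<leftarrow>gs. hermite_sum C P g) =
          (\<Sum>k\<le>degree P. fact k * (C ^ k * (\<Sum>g\<leftarrow>gs. coeff (pcompose P [:g, 1:]) k)))"
        by (induction gs) (simp_all add: hermite_sum_def ring_distribs sum.distrib)
      then show ?thesis
        by (simp add: t_def hermite_sum_def ring_distribs sum.distrib sum_distrib_left mult_ac)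
    qed
    also have "\<dots> = (\<Sum>g\<leftarrow>gs. hermite_sum C P g - exp (g / C) * hermite_sum C P 0)"
    proof -
      have "of_nat K = - (\<Sum>g\<leftarrow>gs. exp (g / C))"
        using rel by (simp add: C_def add_eq_0_iff2)
      then show ?thesis
        by (simp add: sum_list_subtractf sum_list_mult_const)
    qed
    also have "norm \<dots> \<le> (\<Sum>g\<leftarrow>gs. norm (g / C) * exp (norm (g / C)) * (B ^ q * B ^ Suc q))"
    proof (rule norm_sum_list_le)
      fix g assume g: "g \<in> set gs"
      have "dominated (monom 1 q) (monom 1 q)" by (simp add: dominated_def)
      then have "dominated P (monom 1 q * Q ^ Suc q)"
        unfolding P_def by (intro dominated_mult dominated_power dom)
      from dominated_sum_le_poly[OF this, of "norm g"]
      have "(\<Sum>n\<le>degree P. norm (coeff P n) * norm g ^ n) \<le> norm g ^ q * poly Q (norm g) ^ Suc q"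
        by (simp add: poly_monom poly_power del: power_Suc)
      also have "\<dots> \<le> B ^ q * B ^ Suc q"
        using B[OF g] Q_nonneg \<open>B \<ge> 1\<close> by (intro mult_mono power_mono) auto
      finally show "norm (hermite_sum C P g - exp (g / C) * hermite_sum C P 0)
          \<le> norm (g / C) * exp (norm (g / C)) * (B ^ q * B ^ Suc q)"
        by (intro order_trans[OF hermite_sum_approx[OF C]] mult_left_mono) auto
    qed
    also have "\<dots> = E * B * (B ^ 2) ^ q"
      by (simp add: E_def sum_list_mult_const power_mult_distrib power2_eq_square)
    finally show ?thesis .
  qed
  have "(\<lambda>q. E * B * (inverse (fact q) * (B ^ 2) ^ q)) \<longlonglongrightarrow> E * B * 0"
    by (intro tendsto_mult tendsto_const summable_LIMSEQ_zero summable_exp)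
  then have "\<forall>\<^sub>F q in sequentially. E * B * (inverse (fact q) * (B ^ 2) ^ q) < 1"
    by (rule order_tendstoD) simp
  then obtain N where N: "\<And>q. q \<ge> N \<Longrightarrow> E * B * (inverse (fact q) * (B ^ 2) ^ q) < 1"
    unfolding eventually_sequentially by blast
  obtain p where p: "prime p" "p > N + K + c + nat \<bar>m\<bar>"
    using bigger_prime by blast
  then obtain q where "p = Suc q" by (cases p) auto
  with p lower_upper[of q] N[of q] show False
    by (simp add: field_simps)
qed

text \<open>
  The factor \<open>1 + exp (\<i>\<pi>) = 0\<close> makes the sum of \<open>exp\<close> over all subset sums vanish. The empty subset
  contributes a zero subset sum, so after collecting the zero sums the constant term \<open>K\<close> is positive.
\<close>
theorem transcendental_i_pi: "\<not> algebraic (\<i> * of_real pi)"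
proof
  assume "algebraic (\<i> * of_real pi)"
  then obtain xs where xs: "\<i> * of_real pi \<in> set xs" "\<And>k. power_sum xs k \<in> \<rat>"
    unfolding algebraic_iff_rational_power_sums by blast
  define bs where "bs = subset_sums xs"
  define ys where "ys = filter (\<lambda>b. b \<noteq> 0) bs"
  define K where "K = length (filter (\<lambda>b. b = 0) bs)"
  have "(\<Sum>b\<leftarrow>bs. exp b) = 0"
    unfolding bs_def sum_exp_subset_sums using xs(1) by (force simp: prod_list_zero_iff)
  moreover have "(\<Sum>b\<leftarrow>bs. exp b) = of_nat K + (\<Sum>y\<leftarrow>ys. exp y)"
    unfolding ys_def K_def by (induction bs) auto
  ultimately have rel: "of_nat K + (\<Sum>y\<leftarrow>ys. exp y) = 0" by simp
  have "0 \<in> set bs" unfolding bs_def by (rule zero_in_subset_sums)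
  then have "K > 0" unfolding K_def by (auto simp: filter_empty_conv)
  have "power_sum ys k \<in> \<rat>" for k
  proof (cases k)
    case (Suc n)
    have "power_sum ys (Suc n) = power_sum bs (Suc n)"
      unfolding ys_def by (induction bs) auto
    then show ?thesis
      using power_sum_subset_sums_rational[OF xs(2)] Suc by (simp add: bs_def)
  qed simp
  then obtain c :: nat where c: "c > 0" "\<forall>n. coeff (linear_factors (map ((*) (of_nat c)) ys)) n \<in> \<int>"
    using scaled_linear_factors_integral by blast
  have "of_nat K + (\<Sum>g\<leftarrow>map ((*) (of_nat c)) ys. exp (g / of_nat c)) \<noteq> 0"
    using c \<open>K > 0\<close> by (intro sum_exp_integral_roots_nonzero) (auto simp: ys_def)
  then show False
    using rel c(1) by (simp add: o_def)
qed

corollary not_algebraic_pi_squared: "\<not> algebraic ((of_real pi)\<^sup>2 :: complex)"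
proof
  assume "algebraic ((of_real pi)\<^sup>2 :: complex)"
  then have "algebraic (- ((of_real pi)\<^sup>2) :: complex)" by simp
  then have "algebraic (\<i> * of_real pi)"
    by (rule algebraic_root[where p = "monom 1 2"]) (simp_all add: poly_monom power_mult_distrib degree_monom_eq)
  then show False using transcendental_i_pi by blast
qed

section \<open>Derivatives of the Gamma function at positive integers\<close>

text \<open>
  The \<open>n\<close>-th Taylor coefficient of \<open>\<Gamma>\<close> at \<open>N + 1\<close>, divided by \<open>\<Gamma>(N + 1) = N!\<close>. With this normalisation the functional
  equation becomes a difference equation in \<open>N\<close>.
\<close>
definition gamma_taylor :: "nat \<Rightarrow> nat \<Rightarrow> complex" where
  "gamma_taylor n N = (deriv ^^ n) Gamma (of_nat (Suc N)) / (fact n * fact N)"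

lemma gamma_taylor_0: "gamma_taylor 0 N = 1"
  using Gamma_fact[of N, where 'a = complex] by (simp add: gamma_taylor_def add.commute)

text \<open>
  Leibniz's rule for \<open>z \<Gamma>(z)\<close>: only the derivatives of order \<open>0\<close> and \<open>1\<close> of the factor \<open>z\<close> survive.
\<close>
lemma higher_deriv_Gamma_plus1:
  assumes "Re z > 0"
  shows "(deriv ^^ Suc n) Gamma (z + 1) =
    z * (deriv ^^ Suc n) Gamma z + of_nat (Suc n) * (deriv ^^ n) Gamma z"
proof -
  let ?S = "{z. Re z > 0}"
  have open_S: "open ?S" by (rule open_halfspace_Re_gt)
  have nonpos: "w \<notin> \<int>\<^sub>\<le>\<^sub>0" if "w \<in> ?S" for w
    using that by (auto elim!: nonpos_Ints_cases)
  have hol: "Gamma holomorphic_on ?S"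
    using nonpos by (intro holomorphic_Gamma) auto
  have hol1: "(\<lambda>w. Gamma (w + 1)) holomorphic_on ?S"
    by (rule holomorphic_on_compose_gen[of "\<lambda>w. w + 1" ?S Gamma ?S, unfolded o_def])
       (auto intro!: holomorphic_intros hol)
  have "(deriv ^^ Suc n) Gamma (z + 1) = (deriv ^^ Suc n) (\<lambda>w. Gamma (1 * w + 1)) z"
    using higher_deriv_compose_linear'[OF hol open_S open_S, of z 1 1 "Suc n"] assms by simp
  also have "\<dots> = (deriv ^^ Suc n) (\<lambda>w. w * Gamma w) z"
    using assms open_S hol1 nonpos
    by (intro higher_deriv_transform_within_open[of _ ?S]) (auto intro!: holomorphic_intros hol simp: Gamma_plus1)
  also have "\<dots> = (\<Sum>i=0..Suc n. of_nat (Suc n choose i) * (deriv ^^ i) (\<lambda>w. w) z * (deriv ^^ (Suc n - i)) Gamma z)"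
    using assms open_S hol by (intro higher_deriv_mult[of _ ?S]) (auto intro!: holomorphic_intros)
  also have "\<dots> = (\<Sum>i\<in>{0,1}. of_nat (Suc n choose i) * (deriv ^^ i) (\<lambda>w. w) z * (deriv ^^ (Suc n - i)) Gamma z)"
    by (rule sum.mono_neutral_right) (auto simp: higher_deriv_ident)
  also have "\<dots> = z * (deriv ^^ Suc n) Gamma z + of_nat (Suc n) * (deriv ^^ n) Gamma z"
    by (simp add: of_nat_1[unfolded One_nat_def] del: funpow.simps of_nat_Suc)
  finally show ?thesis .
qed

lemma gamma_taylor_step:
  "gamma_taylor (Suc n) (Suc N) - gamma_taylor (Suc n) N = gamma_taylor n N / of_nat (Suc N)"
proof -
  have "(deriv ^^ Suc n) Gamma (of_nat (Suc N) + 1 :: complex) =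
    of_nat (Suc N) * (deriv ^^ Suc n) Gamma (of_nat (Suc N)) + of_nat (Suc n) * (deriv ^^ n) Gamma (of_nat (Suc N))"
    by (rule higher_deriv_Gamma_plus1) simp
  then have step: "(deriv ^^ Suc n) Gamma (of_nat (Suc (Suc N)) :: complex) =
    of_nat (Suc N) * (deriv ^^ Suc n) Gamma (of_nat (Suc N)) + of_nat (Suc n) * (deriv ^^ n) Gamma (of_nat (Suc N))"
    by (simp only: of_nat_Suc add.commute)
  have quotient: "(a * x + b * y) / (b * f * (a * g)) - x / (b * f * g) = y / (f * g) / a"
    if "a \<noteq> 0" "b \<noteq> 0" "f \<noteq> 0" "g \<noteq> 0" for a b f g x y :: complex
    using that by (simp add: field_simps)
  show ?thesis
    unfolding gamma_taylor_def step fact_Suc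
    by (rule quotient) (simp_all del: of_nat_Suc)
qed

section \<open>Zeros of solutions of the difference equation\<close>

text \<open>
  Discrete Rolle. Between two arguments at which row \<open>n + 1\<close> has weakly opposite signs, one of its differences, hence an entry
  of row \<open>n\<close>, has the sign of the total change or is zero. So \<open>n + 2\<close> weakly alternating entries of row \<open>n + 1\<close> yield \<open>n + 1\<close> weakly
  alternating entries of row \<open>n\<close>, which then vanishes by induction; row \<open>n + 1\<close> is constant, and a constant with weakly
  alternating signs is zero. Zeros count as either sign, since a sequence on the integers may
  change sign without taking the value \<open>0\<close>. The sign \<open>(-1)\<^sup>n\<^sup>+\<^sup>i\<close> is anchored at the
  last argument, which keeps it consistent from one row to the next.
\<close>
lemma vanishing_of_weak_alternation:
  fixes w :: "nat \<Rightarrow> nat \<Rightarrow> 'a :: linordered_field"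
  assumes step: "\<And>n N. w (Suc n) (Suc N) - w (Suc n) N = w n N / of_nat (Suc N)"
    and w0: "\<And>N. w 0 N = 0"
    and mono: "strict_mono_on {..n} s"
    and alt: "\<And>i. i \<le> n \<Longrightarrow> (-1) ^ (n + i) * w n (s i) \<ge> 0"
  shows "w n N = 0"
  using mono alt
proof (induction n arbitrary: s N)
  case 0
  then show ?case by (simp add: w0)
next
  case (Suc n)
  have exch: "\<exists>M\<ge>s i. M < s (Suc i) \<and> (-1) ^ (n + i) * w n M \<ge> 0" if i: "i \<le> n" for i
  proof (rule ccontr)
    assume "\<not> ?thesis"
    then have neg: "(-1) ^ (n + i) * w n M < 0" if "s i \<le> M" "M < s (Suc i)" for M
      using that by force
    have lt: "s i < s (Suc i)"
      using Suc.prems(1) i by (auto simp: strict_mono_on_def)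
    have "(-1) ^ (n + i) * (w (Suc n) (s (Suc i)) - w (Suc n) (s i)) =
        (\<Sum>M=s i..<s (Suc i). (-1) ^ (n + i) * (w (Suc n) (Suc M) - w (Suc n) M))"
      using lt by (simp add: sum_Suc_diff' flip: sum_distrib_left)
    also have "\<dots> = (\<Sum>M=s i..<s (Suc i). (-1) ^ (n + i) * w n M / of_nat (Suc M))"
      by (simp only: step times_divide_eq_right)
    also have "\<dots> < (\<Sum>M=s i..<s (Suc i). 0)"
      using lt neg by (intro sum_strict_mono divide_neg_pos) (auto simp del: of_nat_Suc)
    finally have "(-1) ^ (n + i) * w (Suc n) (s (Suc i)) < (-1) ^ (n + i) * w (Suc n) (s i)"
      by (simp add: right_diff_distrib)
    moreover have "(-1) ^ (n + i) * w (Suc n) (s i) \<le> 0" "(-1) ^ (n + i) * w (Suc n) (s (Suc i)) \<ge> 0"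
      using Suc.prems(2)[of i] Suc.prems(2)[of "Suc i"] i by auto
    ultimately show False by linarith
  qed
  then have "\<forall>i\<in>{..n}. \<exists>M. s i \<le> M \<and> M < s (Suc i) \<and> (-1) ^ (n + i) * w n M \<ge> 0"
    by auto
  then obtain r where
    r: "\<forall>i\<in>{..n}. s i \<le> r i \<and> r i < s (Suc i) \<and> (-1) ^ (n + i) * w n (r i) \<ge> 0"
    by (rule bchoice[THEN exE])
  have r_mono: "strict_mono_on {..n} r"
  proof (rule strict_mono_onI)
    fix i j assume ij: "i \<in> {..n}" "j \<in> {..n}" "i < j"
    then have "s (Suc i) \<le> s j"
      using Suc.prems(1) by (cases "Suc i = j") (auto simp: strict_mono_on_def less_imp_le)
    moreover have "r i < s (Suc i)" "s j \<le> r j"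
      using r ij by blast+
    ultimately show "r i < r j" by linarith
  qed
  have "w n M = 0" for M
    using r by (intro Suc.IH[OF r_mono]) auto
  then have "w (Suc n) (Suc M) = w (Suc n) M" for M
    using step[of n M] by simp
  then have const: "w (Suc n) M = w (Suc n) N" for M
  proof -
    have "w (Suc n) M = w (Suc n) 0" for M
      by (induction M) (simp_all add: \<open>\<And>M. w (Suc n) (Suc M) = w (Suc n) M\<close>)
    then show ?thesis by metis
  qed
  have "(-1) ^ Suc n * w (Suc n) N \<ge> 0" "(-1) ^ Suc n * w (Suc n) N \<le> 0"
    using Suc.prems(2)[of 0] Suc.prems(2)[of 1] const[of "s 0"] const[of "s 1"] by simp_all
  then have "(-1) ^ Suc n * w (Suc n) N = 0" by linarith
  then show ?case by simp
qed

text \<open>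
  At \<open>n\<close> zeros any sign pattern is weakly realised, and one further argument to the right of them supplies the
  missing alternation, after replacing \<open>w\<close> by \<open>- w\<close> if its sign there is negative.
\<close>
lemma vanishing_of_zeros:
  fixes w :: "nat \<Rightarrow> nat \<Rightarrow> 'a :: linordered_field"
  assumes step: "\<And>n N. w (Suc n) (Suc N) - w (Suc n) N = w n N / of_nat (Suc N)"
    and w0: "\<And>N. w 0 N = 0"
    and A: "finite A" "card A = n" "\<And>N. N \<in> A \<Longrightarrow> w n N = 0"
  shows "w n N = 0"
proof -
  obtain h where h: "bij_betw h {..<n} A" "strict_mono_on {..<n} h"
    using ex_bij_betw_strict_mono_card[OF A(1)] A(2) by auto
  \<comment> \<open>Inserting \<open>0\<close> covers the case of an empty \<open>A\<close>.\<close>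
  define L where "L = Suc (Max (insert 0 A))"
  define s where "s i = (if i < n then h i else L)" for i
  have h_A: "h i \<in> A" if "i < n" for i
    using h(1) that by (auto simp: bij_betw_def)
  then have "h i < L" if "i < n" for i
    unfolding L_def using A(1) that by (simp add: less_Suc_eq_le)
  then have s: "strict_mono_on {..n} s"
    using h(2) by (auto simp: strict_mono_on_def s_def)
  have zero: "w n (s i) = 0" if "i < n" for i
    using that A(3) h_A by (simp add: s_def)
  show ?thesis
  proof (cases "w n L \<ge> 0")
    case True
    have "(-1) ^ (n + i) * w n (s i) \<ge> 0" if "i \<le> n" for i
      using that True zero by (cases "i = n") (simp_all add: s_def)
    from vanishing_of_weak_alternation[of w, OF step w0 s this] show ?thesis .
  next
    case False
    have alt: "(-1) ^ (n + i) * - w n (s i) \<ge> 0" if "i \<le> n" for i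
      using that False zero by (cases "i = n") (simp_all add: s_def)
    have step': "- w (Suc n) (Suc N) - - w (Suc n) N = - w n N / of_nat (Suc N)" for n N
      using step[of n N] by (simp del: of_nat_Suc add: algebra_simps)
    have "- w n N = 0"
      by (rule vanishing_of_weak_alternation[of "\<lambda>n N. - w n N", OF step' _ s alt]) (simp_all add: w0)
    then show ?thesis by simp
  qed
qed

lemma vanishing_lower_rows:
  fixes w :: "nat \<Rightarrow> nat \<Rightarrow> 'a :: linordered_field"
  assumes step: "\<And>n N. w (Suc n) (Suc N) - w (Suc n) N = w n N / of_nat (Suc N)"
    and "\<And>N. w n N = 0" "k \<le> n"
  shows "w k N = 0"
  using \<open>k \<le> n\<close>
proof (induction k arbitrary: N rule: inc_induct)
  case base
  then show ?case by fact
next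
  case (step k)
  then show ?case using assms(1)[of k N] by (simp del: of_nat_Suc)
qed

section \<open>A rational functional vanishing on the algebraic numbers\<close>

text \<open>
  The algebraic numbers form a rational subspace. A basis of it stays independent after adding a number outside it, so a linear map may
  be prescribed on the enlarged basis.
\<close>
lemma rational_functional:
  assumes "\<not> algebraic (x :: complex)"
  obtains \<phi> :: "complex \<Rightarrow> rat" where
    "\<And>a b. \<phi> (a + b) = \<phi> a + \<phi> b" "\<And>q a. \<phi> (of_rat q * a) = q * \<phi> a"
    "\<And>a. algebraic a \<Longrightarrow> \<phi> a = 0" "\<phi> x = 1"
proof -
  interpret V: vector_space "\<lambda>(q :: rat) (z :: complex). of_rat q * z"
    by standard (simp_all add: algebra_simps of_rat_add of_rat_mult)
  interpret W: vector_space "(*) :: rat \<Rightarrow> rat \<Rightarrow> rat"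
    by standard (simp_all add: algebra_simps)
  interpret VW: vector_space_pair "\<lambda>(q :: rat) (z :: complex). of_rat q * z" "(*) :: rat \<Rightarrow> rat \<Rightarrow> rat" ..
  let ?K = "{a :: complex. algebraic a}"
  have K: "V.subspace ?K"
    by (auto simp: V.subspace_def intro: algebraic_add algebraic_mult[OF rat_imp_algebraic])
  obtain B where B: "B \<subseteq> ?K" "V.independent B" "?K \<subseteq> V.span B"
    using V.maximal_independent_subset by blast
  have "V.span B \<subseteq> ?K"
    using V.span_minimal[OF B(1) K] .
  then have "x \<notin> V.span B" using assms by blast
  then have "V.independent (insert x B)"
    using B(2) V.independent_insertI by blast
  then obtain \<phi> where lin: "Vector_Spaces.linear (\<lambda>(q :: rat) (z :: complex). of_rat q * z) ((*) :: rat \<Rightarrow> rat \<Rightarrow> rat) \<phi>"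
    and \<phi>: "\<forall>b\<in>insert x B. \<phi> b = (if b = x then 1 else 0)"
    using VW.linear_independent_extend[of "insert x B" "\<lambda>b. if b = x then 1 else 0"] by blast
  interpret \<phi>: Vector_Spaces.linear "\<lambda>(q :: rat) (z :: complex). of_rat q * z" "(*) :: rat \<Rightarrow> rat \<Rightarrow> rat" \<phi>
    by (rule lin)
  show ?thesis
  proof
    show "\<phi> a = 0" if "algebraic a" for a
    proof -
      have "x \<notin> B" using B(1) assms by blast
      have "a \<in> V.span B" using that B(3) by blast
      moreover have "\<phi> b = 0" if "b \<in> B" for b
        using \<phi> \<open>x \<notin> B\<close> that by auto
      ultimately show ?thesis
        using VW.linear_eq_0_on_span[OF lin] by blast
    qed
  qed (use \<phi> in \<open>auto simp: \<phi>.add \<phi>.scale\<close>)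
qed

section \<open>At most \<open>n - 1\<close> algebraic values\<close>

lemma Polygamma_1_1: "Polygamma 1 (1 :: complex) = (of_real pi)\<^sup>2 / 6"
proof -
  have "(\<lambda>k. of_real (1 / real ((k + 1)\<^sup>2))) sums (of_real (pi\<^sup>2 / 6) :: complex)"
    using sums_of_real[OF inverse_squares_sums] .
  moreover have "(\<lambda>k. of_real (1 / real ((k + 1)\<^sup>2))) = (\<lambda>k. inverse ((1 + of_nat k) ^ Suc 1) :: complex)"
    by (intro ext) (simp add: inverse_eq_divide power2_eq_square add.commute algebra_simps)
  moreover have "(\<lambda>k. inverse ((1 + of_nat k) ^ Suc 1)) sums ((-1) ^ Suc 1 * Polygamma 1 1 / fact 1 :: complex)"
    by (rule Polygamma_LIMSEQ) simp_all
  ultimately have "(-1) ^ Suc 1 * Polygamma 1 1 / fact 1 = (of_real (pi\<^sup>2 / 6) :: complex)"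
    using sums_unique2 by metis
  then show ?thesis by simp
qed

text \<open>
  Since \<open>\<Gamma>' = \<Gamma> \<psi>\<close> with the digamma function \<open>\<psi>\<close>, the second derivative at \<open>1\<close> is \<open>\<psi>(1)\<^sup>2 + \<psi>'(1)\<close>, and
  \<open>\<psi>'(1)\<close> is the sum of the inverse squares.
\<close>
lemma deriv_deriv_Gamma_1:
  "(deriv ^^ 2) Gamma (1 :: complex) = (deriv Gamma 1)\<^sup>2 + (of_real pi)\<^sup>2 / 6"
proof -
  let ?S = "{z. Re z > 0}"
  have nonpos: "w \<notin> \<int>\<^sub>\<le>\<^sub>0" if "w \<in> ?S" for w
    using that by (auto elim!: nonpos_Ints_cases)
  have D: "deriv Gamma w = Gamma w * Digamma w" if "w \<in> ?S" for w :: complex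
    using nonpos[OF that] by (intro DERIV_imp_deriv has_field_derivative_Gamma)
  have "((\<lambda>w. Gamma w * Digamma w) has_field_derivative
      Gamma 1 * Digamma 1 * Digamma 1 + Polygamma 1 1 * Gamma 1) (at (1 :: complex))"
    by (rule derivative_eq_intros refl nonpos | simp)+
  then have "(deriv Gamma has_field_derivative
      Gamma 1 * Digamma 1 * Digamma 1 + Polygamma 1 1 * Gamma 1) (at (1 :: complex))"
    by (rule has_field_derivative_transform_within_open[of _ _ _ ?S])
       (auto simp: D open_halfspace_Re_gt)
  then have "deriv (deriv Gamma) 1 = Gamma 1 * Digamma 1 * Digamma 1 + Polygamma 1 (1 :: complex) * Gamma 1"
    by (rule DERIV_imp_deriv)
  then show ?thesis
    unfolding Polygamma_1_1 using D[of 1] by (simp add: numeral_2_eq_2)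
qed

lemma not_both_algebraic_derivs_Gamma_1:
  "\<not> (algebraic (deriv Gamma (1 :: complex)) \<and> algebraic ((deriv ^^ 2) Gamma (1 :: complex)))"
proof
  assume *: "algebraic (deriv Gamma (1 :: complex)) \<and> algebraic ((deriv ^^ 2) Gamma (1 :: complex))"
  have "algebraic (6 * ((deriv ^^ 2) Gamma (1 :: complex) + - (deriv Gamma 1 * deriv Gamma 1)))"
    using * by (intro algebraic_mult algebraic_add algebraic_minus) auto
  then have "algebraic ((of_real pi)\<^sup>2 :: complex)"
    unfolding deriv_deriv_Gamma_1 by (simp add: power2_eq_square)
  then show False using not_algebraic_pi_squared by blast
qed

text \<open>
  Assume \<open>n\<close> algebraic values. For every functional \<open>\<phi>\<close> vanishing on algebraic numbers, row \<open>n\<close> of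
  \<open>\<phi> (gamma_taylor n N)\<close> has \<open>n\<close> zeros, so the rows up to \<open>n\<close> vanish. Hence all \<open>gamma_taylor k 0\<close> with \<open>k \<le> n\<close>
  are algebraic, and \<open>k = 1, 2\<close> contradict the transcendence of \<open>\<pi>\<close>.
\<close>
theorem algebraic_derivs_bound:
  assumes "n \<ge> 2"
    and A: "finite A" "\<And>m. m \<in> A \<Longrightarrow> m \<ge> 1 \<and> algebraic ((deriv ^^ n) Gamma (of_nat m :: complex))"
  shows "card A < n"
proof (rule ccontr)
  assume "\<not> card A < n"
  then obtain A' where A': "A' \<subseteq> A" "card A' = n" "finite A'"
    using obtain_subset_with_card_n[of n A] by (auto simp: not_less)
  define Z where "Z = (\<lambda>m. m - 1) ` A'"
  have "inj_on (\<lambda>m. m - 1) A'"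
    using A(2) A'(1) by (intro inj_onI) (metis in_mono le_add_diff_inverse)
  then have Z: "finite Z" "card Z = n"
    using A' by (simp_all add: Z_def card_image)
  have alg_Z: "algebraic (gamma_taylor n N)" if N: "N \<in> Z" for N
  proof -
    obtain m where m: "m \<in> A" "N = m - 1"
      using N A'(1) unfolding Z_def by blast
    then have "Suc N = m" using A(2)[of m] by simp
    then have "algebraic ((deriv ^^ n) Gamma (of_nat (Suc N) :: complex))"
      using A(2) m by blast
    moreover have "algebraic (inverse (fact n * fact N :: complex))"
      by (intro algebraic_inverse rat_imp_algebraic Rats_mult) (metis Rats_of_nat of_nat_fact)+
    ultimately show ?thesis
      unfolding gamma_taylor_def divide_inverse by (rule algebraic_mult)
  qed
  have alg: "algebraic (gamma_taylor k 0)" if "k \<le> n" for k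
  proof (rule ccontr)
    assume "\<not> algebraic (gamma_taylor k 0)"
    then obtain \<phi> :: "complex \<Rightarrow> rat" where
      add: "\<And>a b. \<phi> (a + b) = \<phi> a + \<phi> b" and scale: "\<And>q a. \<phi> (of_rat q * a) = q * \<phi> a"
      and alg: "\<And>a. algebraic a \<Longrightarrow> \<phi> a = 0" and one: "\<phi> (gamma_taylor k 0) = 1"
      by (rule rational_functional) blast
    define w where "w n N = \<phi> (gamma_taylor n N)" for n N
    have step: "w (Suc n) (Suc N) - w (Suc n) N = w n N / of_nat (Suc N)" for n N
    proof -
      have "gamma_taylor (Suc n) (Suc N) =
          gamma_taylor (Suc n) N + of_rat (1 / of_nat (Suc N)) * gamma_taylor n N"
        using gamma_taylor_step[of n N]
        by (simp add: of_rat_divide field_simps del: of_nat_Suc)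
      then show ?thesis
        unfolding w_def by (simp add: add scale del: of_nat_Suc)
    qed
    have w0: "w 0 N = 0" for N
      by (simp add: w_def gamma_taylor_0 alg)
    have "w n N = 0" for N
      using vanishing_of_zeros[of w, OF step w0 Z] alg_Z alg by (simp add: w_def)
    then have "w k 0 = 0"
      using vanishing_lower_rows[of w, OF step _ \<open>k \<le> n\<close>] by blast
    then show False using one by (simp add: w_def)
  qed
  have "algebraic (deriv Gamma (1 :: complex))"
    using alg[of 1] \<open>n \<ge> 2\<close> by (simp add: gamma_taylor_def)
  moreover have "algebraic ((deriv ^^ 2) Gamma (1 :: complex))"
    using algebraic_mult[OF algebraic_numeral[of "num.Bit0 num.One"] alg[of 2]] \<open>n \<ge> 2\<close>
    by (simp add: gamma_taylor_def)
  ultimately show False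
    using not_both_algebraic_derivs_Gamma_1 by blast
qed

theorem corollary1:
  fixes n :: nat
  assumes "n \<ge> 2"
  shows "(\<forall>M::nat. M \<ge> 1 \<longrightarrow> transcendence_density n M \<ge> density_bound n M) \<and>
         (\<lambda>M::nat. density_bound n M) \<sim>[at_top] (\<lambda>M. 1 - (real n - 1) / real M)"
proof (intro conjI allI impI)
  fix M :: nat
  assume M: "M \<ge> 1"
  let ?T = "{m \<in> {1..M}. transcendental ((deriv ^^ n) Gamma (of_nat m))}"
  let ?A = "{m \<in> {1..M}. algebraic ((deriv ^^ n) Gamma (of_nat m :: complex))}"
  have "card (?T \<union> ?A) = card ?T + card ?A"
    by (intro card_Un_disjoint) (auto simp: transcendental_def)
  moreover have "?T \<union> ?A = {1..M}"
    by (auto simp: transcendental_def)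
  ultimately have "M = card ?T + card ?A" by simp
  moreover have "card ?A < n"
    using assms by (intro algebraic_derivs_bound) auto
  ultimately have "real M - min (real n - 1) (real M) \<le> real (card ?T)"
    by linarith
  then have "(real M - min (real n - 1) (real M)) / real M \<le> real (card ?T) / real M"
    by (intro divide_right_mono) simp_all
  then show "transcendence_density n M \<ge> density_bound n M"
    using M by (simp add: transcendence_density_def density_bound_def diff_divide_distrib)
next
  have "\<forall>\<^sub>F M in at_top. density_bound n M = 1 - (real n - 1) / real M"
    using eventually_ge_at_top[of n]
    by eventually_elim (simp add: density_bound_def)
  then show "(\<lambda>M::nat. density_bound n M) \<sim>[at_top] (\<lambda>M. 1 - (real n - 1) / real M)"
    by (rule asymp_equiv_refl_ev)
qed

end
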